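(* Let $n\ge1$ and let $\{\alpha^i_j\}$, $i=1,\dots,n$, $j\in\mathbb{N}$, be real numbers such that for each $i$ we have $\alpha^i_0<\alpha^i_1<\alpha^i_2<\cdots$. For $J=(j_1,\dots,j_n)\in\mathbb{N}^n$ put $\vec{\alpha}_J=(\alpha^1_{j_1},\dots,\alpha^n_{j_n})$, and for $S\subseteq\mathbb{N}^n$ put $R_S=\{\vec{\alpha}_J\mid J\in S\}$. Then for any $S\subseteq \mathbb{N}^n$ and any tropical polynomial $p$ that has at least one monomial and satisfies $\mathrm{Supp}(p)\subseteq S$, there is $\vec{r}\in R_S$ such that $\vec{r}$ is a non-root of $p$.
   Context: $\mathbb{N}$ includes $0$. A tropical polynomial over $\mathbb{R}$ in $\vec{x}=(x_1,\dots,x_n)$ is a finite collection of tropical monomials $m_J(\vec{x}) = c_J + j_1x_1+\dots+j_nx_n$ with pairwise distinct exponent vectors $J=(j_1,\dots,j_n)\in\mathbb{N}^n$ and constants $c_J\in\mathbb{R}$; its value is $p(\vec{x})=\max_J m_J(\vec{x})$. $\mathrm{Supp}(p)$ is the set of exponent vectors $J$ of the monomials occurring in $p$. A point $\vec{a}\in\mathbb{R}^n$ is a root of $p$ if the maximum $\max_J m_J(\vec{a})$ is attained on at least two distinct monomials; otherwise it is a non-root. *)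

theory Defs
  imports "HOL-Analysis.Analysis" "HOL-Library.Finite_Map"
begin

text \<open>
  A tropical polynomial is a finite map from exponent vectors to constants; the empty map is
  the polynomial without monomials, and a constant \<open>0\<close> is an ordinary tropical
  coefficient, not an absent monomial.
\<close>

type_synonym 'n trop_poly = "(nat ^ 'n, real) fmap"

definition Supp :: "'n trop_poly \<Rightarrow> (nat ^ 'n) set" where
  "Supp p = fmdom' p"

text \<open>Only meaningful for \<open>J \<in> Supp p\<close>.\<close>

definition trop_monom :: "'n::finite trop_poly \<Rightarrow> nat ^ 'n \<Rightarrow> real ^ 'n \<Rightarrow> real" where
  "trop_monom p J x = the (fmlookup p J) + (\<Sum>i\<in>UNIV. real (J $ i) * x $ i)"

text \<open>Only meaningful for \<open>p\<close> with at least one monomial.\<close>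

definition trop_eval :: "'n::finite trop_poly \<Rightarrow> real ^ 'n \<Rightarrow> real" where
  "trop_eval p x = Max ((\<lambda>J. trop_monom p J x) ` Supp p)"

definition trop_root :: "'n::finite trop_poly \<Rightarrow> real ^ 'n \<Rightarrow> bool" where
  "trop_root p a \<longleftrightarrow>
     (\<exists>J\<in>Supp p. \<exists>K\<in>Supp p. J \<noteq> K \<and>
        trop_monom p J a = trop_eval p a \<and> trop_monom p K a = trop_eval p a)"

definition grid_point :: "('n::finite \<Rightarrow> nat \<Rightarrow> real) \<Rightarrow> nat ^ 'n \<Rightarrow> real ^ 'n" where
  "grid_point \<alpha> J = (\<chi> i. \<alpha> i (J $ i))"

definition grid :: "('n::finite \<Rightarrow> nat \<Rightarrow> real) \<Rightarrow> (nat ^ 'n) set \<Rightarrow> (real ^ 'n) set" where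
  "grid \<alpha> S = {grid_point \<alpha> J | J. J \<in> S}"

end

theory Submission imports Defs begin

text \<open>
  The point is that a strictly increasing sequence is a choice of slopes of a strictly convex
  function: for every \<open>i\<close> there is a function \<open>F\<^sub>i\<close> on the natural numbers whose graph lies
  strictly above the line of slope \<open>\<alpha> i j\<close> through \<open>(j, F\<^sub>i j)\<close>, except at \<open>j\<close> itself
  (\<open>convex_potential_above_tangent\<close>). Summing over the coordinates, the linear form with
  coefficients \<open>grid_point \<alpha> J\<close> is tangent at \<open>J\<close> to the separable function with summands
  \<open>F\<^sub>i\<close>, and lies strictly below it at every other exponent vector.

  Now let \<open>J\<close> maximize \<open>c\<^sub>J + (\<Sum>i\<in>UNIV. F\<^sub>i (J $ i))\<close> over the finitely many monomials of
  \<open>p\<close>, where \<open>c\<^sub>J\<close> is the coefficient. Passing from \<open>J\<close> to another \<open>K\<close> changes the value of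
  the monomial at \<open>grid_point \<alpha> J\<close> by strictly less than it changes this quantity
  (\<open>trop_monom_diff_less_lifted_coeff_diff\<close>), hence by a negative amount.
  So \<open>J\<close> is the only monomial attaining the maximum at its own grid point, which lies in the grid
  because \<open>J \<in> Supp p \<subseteq> S\<close>.
\<close>

text \<open>
  The increment from \<open>k\<close> to \<open>Suc k\<close> is the midpoint of \<open>a k\<close> and \<open>a (Suc k)\<close>; any value
  strictly between the two would serve. Taking an endpoint instead would make the function touch
  its tangent at a neighbouring integer, and uniqueness of the maximal monomial could be lost.
\<close>

definition convex_potential :: "(nat \<Rightarrow> real) \<Rightarrow> nat \<Rightarrow> real" where
  "convex_potential a j = (\<Sum>k<j. (a k + a (Suc k)) / 2)"

text \<open>
  To the right of \<open>j\<close> every increment of the potential exceeds \<open>a j\<close>, to the left every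
  increment is smaller than \<open>a j\<close>.
\<close>

lemma convex_potential_above_tangent:
  assumes a: "strict_mono a" and "k \<noteq> j"
  shows "a j * (real k - real j) < convex_potential a k - convex_potential a j"
proof -
  have right: "a j * real (Suc d) < convex_potential a (j + Suc d) - convex_potential a j" for j d
  proof (induction d)
    case 0
    have "a j < a (Suc j)" using a by (simp add: strict_mono_def)
    then show ?case by (simp add: convex_potential_def)
  next
    case (Suc d)
    have "a j < a (j + Suc d)" "a j < a (Suc (j + Suc d))"
      using a by (simp_all add: strict_mono_def)
    then have "a j < (a (j + Suc d) + a (Suc (j + Suc d))) / 2" by simp
    moreover have "convex_potential a (j + Suc (Suc d))
        = convex_potential a (j + Suc d) + (a (j + Suc d) + a (Suc (j + Suc d))) / 2"
      by (simp add: convex_potential_def)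
    moreover have "a j * real (Suc (Suc d)) = a j * real (Suc d) + a j"
      by (simp add: algebra_simps)
    ultimately show ?case using Suc by linarith
  qed
  have left: "convex_potential a (k + Suc d) - convex_potential a k < a (k + Suc d) * real (Suc d)"
    for k d
  proof (induction d)
    case 0
    have "a k < a (Suc k)" using a by (simp add: strict_mono_def)
    then show ?case by (simp add: convex_potential_def)
  next
    case (Suc d)
    have less: "a (k + Suc d) < a (k + Suc (Suc d))" using a by (simp add: strict_mono_def)
    then have "(a (k + Suc d) + a (k + Suc (Suc d))) / 2 < a (k + Suc (Suc d))" by simp
    moreover have "a (k + Suc d) * real (Suc d) \<le> a (k + Suc (Suc d)) * real (Suc d)"
      using less by (intro mult_right_mono) auto
    moreover have "convex_potential a (k + Suc (Suc d))
        = convex_potential a (k + Suc d) + (a (k + Suc d) + a (k + Suc (Suc d))) / 2"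
      by (simp add: convex_potential_def)
    moreover have "a (k + Suc (Suc d)) * real (Suc (Suc d))
        = a (k + Suc (Suc d)) * real (Suc d) + a (k + Suc (Suc d))"
      by (simp add: algebra_simps)
    ultimately show ?case using Suc by linarith
  qed
  show ?thesis
  proof (cases "j < k")
    case True
    then obtain d where "k = j + Suc d" using less_imp_Suc_add by fastforce
    then show ?thesis using right[of j d] by simp
  next
    case False
    with \<open>k \<noteq> j\<close> obtain d where "j = k + Suc d"
      using less_imp_Suc_add[of k j] by fastforce
    then show ?thesis using left[of k d] by (simp add: algebra_simps)
  qed
qed

definition lifted_coeff ::
    "('n::finite \<Rightarrow> nat \<Rightarrow> real) \<Rightarrow> 'n trop_poly \<Rightarrow> nat ^ 'n \<Rightarrow> real" where
  "lifted_coeff \<alpha> p J = the (fmlookup p J) + (\<Sum>i\<in>UNIV. convex_potential (\<alpha> i) (J $ i))"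

text \<open>
  The constants on both sides cancel, and what is left is the tangent inequality summed over the
  coordinates; it is strict in a coordinate where \<open>K\<close> and \<open>J\<close> differ.
\<close>

lemma trop_monom_diff_less_lifted_coeff_diff:
  fixes \<alpha> :: "'n::finite \<Rightarrow> nat \<Rightarrow> real"
  assumes \<alpha>: "\<And>i. strict_mono (\<alpha> i)" and "K \<noteq> J"
  shows "trop_monom p K (grid_point \<alpha> J) - trop_monom p J (grid_point \<alpha> J)
    < lifted_coeff \<alpha> p K - lifted_coeff \<alpha> p J"
proof -
  from \<open>K \<noteq> J\<close> obtain i where i: "K $ i \<noteq> J $ i" by (auto simp: vec_eq_iff)
  have "(\<Sum>i\<in>UNIV. \<alpha> i (J $ i) * (real (K $ i) - real (J $ i)))
      < (\<Sum>i\<in>UNIV. convex_potential (\<alpha> i) (K $ i) - convex_potential (\<alpha> i) (J $ i))"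
  proof (rule sum_strict_mono_ex1)
    show "\<forall>i\<in>UNIV. \<alpha> i (J $ i) * (real (K $ i) - real (J $ i))
        \<le> convex_potential (\<alpha> i) (K $ i) - convex_potential (\<alpha> i) (J $ i)"
    proof
      fix i
      show "\<alpha> i (J $ i) * (real (K $ i) - real (J $ i))
          \<le> convex_potential (\<alpha> i) (K $ i) - convex_potential (\<alpha> i) (J $ i)"
        using convex_potential_above_tangent[OF \<alpha>, of "K $ i" "J $ i" i]
        by (cases "K $ i = J $ i") auto
    qed
    show "\<exists>i\<in>UNIV. \<alpha> i (J $ i) * (real (K $ i) - real (J $ i))
        < convex_potential (\<alpha> i) (K $ i) - convex_potential (\<alpha> i) (J $ i)"
      using convex_potential_above_tangent[OF \<alpha> i] by blast
  qed simp
  then show ?thesis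
    by (simp add: trop_monom_def lifted_coeff_def grid_point_def sum_subtractf algebra_simps)
qed

lemma finite_Supp: "finite (Supp p)"
  by (simp add: Supp_def)

lemma strict_max_not_trop_root:
  assumes "J \<in> Supp p"
    and less: "\<And>K. K \<in> Supp p \<Longrightarrow> K \<noteq> J \<Longrightarrow> trop_monom p K x < trop_monom p J x"
  shows "\<not> trop_root p x"
proof -
  have "trop_monom p J x \<le> trop_eval p x"
    unfolding trop_eval_def using \<open>J \<in> Supp p\<close> by (simp add: finite_Supp)
  with less have "K = J" if "K \<in> Supp p" "trop_monom p K x = trop_eval p x" for K
    using that by force
  then show ?thesis by (auto simp: trop_root_def)
qed

theorem theorem5:
  fixes \<alpha> :: "'n::finite \<Rightarrow> nat \<Rightarrow> real"
    and S :: "(nat ^ 'n) set"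
    and p :: "'n trop_poly"
  assumes "\<And>i. strict_mono (\<alpha> i)"
    and "Supp p \<noteq> {}"
    and "Supp p \<subseteq> S"
  shows "\<exists>r\<in>grid \<alpha> S. \<not> trop_root p r"
proof -
  obtain J where J: "J \<in> Supp p"
    and max: "\<And>K. K \<in> Supp p \<Longrightarrow> lifted_coeff \<alpha> p K \<le> lifted_coeff \<alpha> p J"
  proof -
    have "Max (lifted_coeff \<alpha> p ` Supp p) \<in> lifted_coeff \<alpha> p ` Supp p"
      using assms(2) by (simp add: finite_Supp)
    then obtain J where "J \<in> Supp p" "Max (lifted_coeff \<alpha> p ` Supp p) = lifted_coeff \<alpha> p J"
      by blast
    with that show thesis by (metis Max_ge finite_Supp finite_imageI imageI)
  qed
  have "trop_monom p K (grid_point \<alpha> J) < trop_monom p J (grid_point \<alpha> J)"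
    if "K \<in> Supp p" "K \<noteq> J" for K
    using trop_monom_diff_less_lifted_coeff_diff[where \<alpha> = \<alpha> and p = p, OF assms(1) \<open>K \<noteq> J\<close>]
      max[OF \<open>K \<in> Supp p\<close>] by simp
  with J have "\<not> trop_root p (grid_point \<alpha> J)" by (rule strict_max_not_trop_root)
  moreover have "grid_point \<alpha> J \<in> grid \<alpha> S" using J assms(3) by (auto simp: grid_def)
  ultimately show ?thesis by blast
qed

end
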